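(* Let $n\ge 1$ and let $D_n=\langle a,b\mid a^n=b^2=1,\ bab=a^{-1}\rangle$. Let $S=S_1\cup S_2\subseteq D_n\setminus\{1\}$ with $S=S^{-1}$, where $S_1\subseteq\langle a\rangle$ and $S_2\subseteq b\langle a\rangle$. Then $X(D_n,S)$ is integral if and only if for every $1\le h\le\lfloor\frac{n-1}{2}\rfloor$ the following two conditions hold: (i) $\chi_h(S_1)$ and $\chi_h(S_1^2)+\chi_h(S_2^2)$ are integers; (ii) $\Delta_h(S)=2[\chi_h(S_1^2)+\chi_h(S_2^2)]-[\chi_h(S_1)]^2$ is a square number.
   Context: For a finite group $G$ and $S\subseteq G\setminus\{1\}$ with $S=S^{-1}$, the Cayley graph $X(G,S)$ has vertex set $G$, two vertices $x,y$ being adjacent iff $x^{-1}y\in S$. A graph is integral if all eigenvalues of its adjacency matrix are integers. For $1\le h\le\lfloor\frac{n-1}{2}\rfloor$, $\chi_h$ is the irreducible character of $D_n$ with $\chi_h(a^k)=2\cos(\frac{2kh\pi}{n})$ and $\chi_h(ba^k)=0$. For $A\subseteq D_n$, $\chi_h(A)=\sum_{x\in A}\chi_h(x)$ and $\chi_h(A^2)=\sum_{x,y\in A}\chi_h(xy)$ (sum over ordered pairs). A square number is an integer $w^2$ with $w\in\mathbb{Z}$. *)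

theory Defs
  imports
    "HOL-Algebra.Generated_Groups"
    "HOL-Combinatorics.Multiset_Permutations"
    "Graph_Theory.Pair_Digraph"
    "Jordan_Normal_Form.Char_Poly"
begin

text \<open>
  The dihedral group \<open>D\<^sub>n\<close> of order \<open>2n\<close>, for \<open>n \<ge> 1\<close>: the pair \<open>(e, k)\<close> with
  \<open>0 \<le> k < n\<close> stands for the normal form \<open>b\<^sup>e a\<^sup>k\<close>.  The product is forced by
  \<open>a\<^sup>k b = b a\<^sup>-\<^sup>k\<close>.  That this is the group presented by
  \<open>\<langle>a, b | a\<^sup>n = b\<^sup>2 = 1, bab = a\<^sup>-\<^sup>1\<rangle>\<close> is the content of the lemmas
  \<open>dihedral_relations\<close>, \<open>dihedral_generated\<close> and \<open>dihedral_universal\<close> below.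
\<close>

definition dihedral :: "nat \<Rightarrow> (bool \<times> int) monoid" where
  "dihedral n =
    \<lparr> carrier = UNIV \<times> {0..<int n},
      monoid.mult = (\<lambda>(e, k) (f, l). (e \<noteq> f, ((if f then - k else k) + l) mod int n)),
      one = (False, 0) \<rparr>"

text \<open>The reduction modulo \<open>n\<close> in \<open>dih_a\<close> only matters for \<open>n = 1\<close>, where \<open>a = 1\<close>.\<close>

definition dih_a :: "nat \<Rightarrow> bool \<times> int" where
  "dih_a n = (False, 1 mod int n)"

definition dih_b :: "bool \<times> int" where
  "dih_b = (True, 0)"

definition dih_chi :: "nat \<Rightarrow> nat \<Rightarrow> bool \<times> int \<Rightarrow> real" where
  "dih_chi n h = (\<lambda>(e, k). if e then 0 else 2 * cos (2 * of_int k * real h * pi / real n))"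

definition chi_sum :: "nat \<Rightarrow> nat \<Rightarrow> (bool \<times> int) set \<Rightarrow> real" where
  "chi_sum n h A = (\<Sum>x\<in>A. dih_chi n h x)"

definition chi_sum_sq :: "nat \<Rightarrow> nat \<Rightarrow> (bool \<times> int) set \<Rightarrow> real" where
  "chi_sum_sq n h A = (\<Sum>x\<in>A. \<Sum>y\<in>A. dih_chi n h (x \<otimes>\<^bsub>dihedral n\<^esub> y))"

definition Delta :: "nat \<Rightarrow> nat \<Rightarrow> (bool \<times> int) set \<Rightarrow> (bool \<times> int) set \<Rightarrow> real" where
  "Delta n h S1 S2 = 2 * (chi_sum_sq n h S1 + chi_sum_sq n h S2) - (chi_sum n h S1)\<^sup>2"

definition is_square_number :: "real \<Rightarrow> bool" where
  "is_square_number x \<longleftrightarrow> (\<exists>w::int. x = of_int (w\<^sup>2))"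

definition cayley_graph :: "('a, 'm) monoid_scheme \<Rightarrow> 'a set \<Rightarrow> 'a pair_pre_digraph" where
  "cayley_graph G S =
    \<lparr> pverts = carrier G,
      parcs = {(x, y). x \<in> carrier G \<and> y \<in> carrier G \<and> inv\<^bsub>G\<^esub> x \<otimes>\<^bsub>G\<^esub> y \<in> S} \<rparr>"

text \<open>
  Matrices are indexed by natural numbers, so the adjacency matrix is taken with respect to a
  duplicate-free list \<open>vs\<close> of all vertices.  A different enumeration conjugates the matrix
  by a permutation matrix, so quantifying over all of them in \<open>integral_graph\<close> is harmless.
  The eigenvalues are those of a complex matrix.
\<close>

definition adjacency_matrix :: "'a pair_pre_digraph \<Rightarrow> 'a list \<Rightarrow> complex mat" where
  "adjacency_matrix X vs =
    mat (length vs) (length vs) (\<lambda>(i, j). if (vs ! i, vs ! j) \<in> parcs X then 1 else 0)"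

definition integral_graph :: "'a pair_pre_digraph \<Rightarrow> bool" where
  "integral_graph X \<longleftrightarrow> finite (pverts X) \<and>
    (\<forall>vs \<in> permutations_of_set (pverts X). \<forall>l. eigenvalue (adjacency_matrix X vs) l \<longrightarrow> l \<in> \<int>)"


subsection \<open>The dihedral group is the presented group\<close>

lemma dihedral_simps [simp]:
  "carrier (dihedral n) = UNIV \<times> {0..<int n}"
  "\<one>\<^bsub>dihedral n\<^esub> = (False, 0)"
  "(e, k) \<otimes>\<^bsub>dihedral n\<^esub> (f, l) = (e \<noteq> f, ((if f then - k else k) + l) mod int n)"
  by (simp_all add: dihedral_def)

lemma dihedral_group:
  assumes "n \<ge> 1"
  shows "group (dihedral n)"
proof (rule groupI)
  fix x y z
  assume "x \<in> carrier (dihedral n)" "y \<in> carrier (dihedral n)" "z \<in> carrier (dihedral n)"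
  show "x \<otimes>\<^bsub>dihedral n\<^esub> y \<otimes>\<^bsub>dihedral n\<^esub> z = x \<otimes>\<^bsub>dihedral n\<^esub> (y \<otimes>\<^bsub>dihedral n\<^esub> z)"
    by (cases x; cases y; cases z) (auto simp: mod_simps algebra_simps)
next
  fix x assume x: "x \<in> carrier (dihedral n)"
  obtain e k where ek: "x = (e, k)" by (cases x)
  have "(e, (if e then k else - k) mod int n) \<otimes>\<^bsub>dihedral n\<^esub> x = \<one>\<^bsub>dihedral n\<^esub>"
    by (auto simp: ek mod_simps)
  moreover have "(e, (if e then k else - k) mod int n) \<in> carrier (dihedral n)"
    using assms by auto
  ultimately show "\<exists>y\<in>carrier (dihedral n). y \<otimes>\<^bsub>dihedral n\<^esub> x = \<one>\<^bsub>dihedral n\<^esub>" by blast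
qed (use assms in auto)

lemma dihedral_order: "Coset.order (dihedral n) = 2 * n"
  by (simp add: Coset.order_def card_cartesian_product)

lemma dih_a_pow: "n \<ge> 1 \<Longrightarrow> dih_a n [^]\<^bsub>dihedral n\<^esub> (k::nat) = (False, int k mod int n)"
proof (induction k)
  case (Suc k)
  then show ?case
    by (simp add: monoid.nat_pow_Suc[OF group.is_monoid[OF dihedral_group]] dih_a_def mod_simps
        add.commute)
qed (simp add: nat_pow_def)

lemma dih_b_a_pow:
  "n \<ge> 1 \<Longrightarrow> dih_b \<otimes>\<^bsub>dihedral n\<^esub> dih_a n [^]\<^bsub>dihedral n\<^esub> (k::nat) = (True, int k mod int n)"
  by (simp add: dih_a_pow dih_b_def)

lemma dihedral_relations:
  assumes "n \<ge> 1"
  shows "dih_a n \<in> carrier (dihedral n)" "dih_b \<in> carrier (dihedral n)"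
    "dih_a n [^]\<^bsub>dihedral n\<^esub> n = \<one>\<^bsub>dihedral n\<^esub>"
    "dih_b [^]\<^bsub>dihedral n\<^esub> (2::nat) = \<one>\<^bsub>dihedral n\<^esub>"
    "dih_b \<otimes>\<^bsub>dihedral n\<^esub> dih_a n \<otimes>\<^bsub>dihedral n\<^esub> dih_b = inv\<^bsub>dihedral n\<^esub> (dih_a n)"
proof -
  interpret group "dihedral n" using assms by (rule dihedral_group)
  show a: "dih_a n \<in> carrier (dihedral n)" and b: "dih_b \<in> carrier (dihedral n)"
    using assms by (auto simp: dih_a_def dih_b_def)
  show "dih_a n [^]\<^bsub>dihedral n\<^esub> n = \<one>\<^bsub>dihedral n\<^esub>"
    using assms by (simp add: dih_a_pow)
  show "dih_b [^]\<^bsub>dihedral n\<^esub> (2::nat) = \<one>\<^bsub>dihedral n\<^esub>"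
    by (simp add: numeral_2_eq_2 dih_b_def)
  have "dih_b \<otimes>\<^bsub>dihedral n\<^esub> dih_a n \<otimes>\<^bsub>dihedral n\<^esub> dih_b \<otimes>\<^bsub>dihedral n\<^esub> dih_a n = \<one>\<^bsub>dihedral n\<^esub>"
    by (simp add: dih_a_def dih_b_def mod_simps)
  then show "dih_b \<otimes>\<^bsub>dihedral n\<^esub> dih_a n \<otimes>\<^bsub>dihedral n\<^esub> dih_b = inv\<^bsub>dihedral n\<^esub> (dih_a n)"
    using a b by (metis inv_equality m_closed)
qed

lemma dihedral_elems:
  assumes "n \<ge> 1" "x \<in> carrier (dihedral n)"
  shows "\<exists>k<n. x = dih_a n [^]\<^bsub>dihedral n\<^esub> k \<or> x = dih_b \<otimes>\<^bsub>dihedral n\<^esub> dih_a n [^]\<^bsub>dihedral n\<^esub> k"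
proof -
  obtain e k where x: "x = (e, k)" by (cases x)
  obtain m where m: "k = int m" "m < n"
    using assms by (auto simp: x elim: nonneg_int_cases)
  show ?thesis
    by (rule exI[of _ m]) (use assms(1) m in \<open>auto simp: x dih_a_pow dih_b_def\<close>)
qed

lemma dihedral_generated:
  assumes "n \<ge> 1"
  shows "generate (dihedral n) {dih_a n, dih_b} = carrier (dihedral n)"
proof -
  interpret group "dihedral n" using assms by (rule dihedral_group)
  let ?H = "generate (dihedral n) {dih_a n, dih_b}"
  have sub: "subgroup ?H (dihedral n)"
    using dihedral_relations(1,2)[OF assms] by (intro generate_is_subgroup) blast
  have a: "dih_a n [^]\<^bsub>dihedral n\<^esub> k \<in> ?H" for k :: nat
    by (induction k)
      (auto intro: generate.incl subgroup.m_closed[OF sub] simp: subgroup.one_closed[OF sub]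
        simp del: dihedral_simps)
  have "x \<in> ?H" if "x \<in> carrier (dihedral n)" for x
    using dihedral_elems[OF assms that] a
    by (auto intro: generate.incl subgroup.m_closed[OF sub] simp del: dihedral_simps)
  with subgroup.subset[OF sub] show ?thesis by blast
qed

lemma dihedral_universal:
  assumes "n \<ge> 1" "group H" "x \<in> carrier H" "y \<in> carrier H"
    and xn: "x [^]\<^bsub>H\<^esub> n = \<one>\<^bsub>H\<^esub>" and y2: "y [^]\<^bsub>H\<^esub> (2::nat) = \<one>\<^bsub>H\<^esub>"
    and yxy: "y \<otimes>\<^bsub>H\<^esub> x \<otimes>\<^bsub>H\<^esub> y = inv\<^bsub>H\<^esub> x"
  shows "\<exists>\<phi> \<in> hom (dihedral n) H. \<phi> (dih_a n) = x \<and> \<phi> dih_b = y"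
proof -
  interpret H: group H by fact
  note [simp] = \<open>x \<in> carrier H\<close> \<open>y \<in> carrier H\<close>
  have xn': "x [^]\<^bsub>H\<^esub> (k mod int n) = x [^]\<^bsub>H\<^esub> k" for k :: int
  proof -
    have "x [^]\<^bsub>H\<^esub> k = x [^]\<^bsub>H\<^esub> (int n * (k div int n) + k mod int n)" by simp
    also have "\<dots> = (x [^]\<^bsub>H\<^esub> int n) [^]\<^bsub>H\<^esub> (k div int n) \<otimes>\<^bsub>H\<^esub> x [^]\<^bsub>H\<^esub> (k mod int n)"
      by (simp only: H.int_pow_mult H.int_pow_pow \<open>x \<in> carrier H\<close>)
    also have "x [^]\<^bsub>H\<^esub> int n = \<one>\<^bsub>H\<^esub>" using xn by (simp add: int_pow_int)
    finally show ?thesis by simp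
  qed
  have yy: "y \<otimes>\<^bsub>H\<^esub> y = \<one>\<^bsub>H\<^esub>" using y2 by (simp add: numeral_2_eq_2)
  have yy': "y \<otimes>\<^bsub>H\<^esub> (y \<otimes>\<^bsub>H\<^esub> z) = z" if "z \<in> carrier H" for z
    using that by (simp flip: H.m_assoc add: yy)
  have xy1: "x \<otimes>\<^bsub>H\<^esub> y = y \<otimes>\<^bsub>H\<^esub> inv\<^bsub>H\<^esub> x"
    by (simp flip: yxy add: H.m_assoc yy')
  have xyn: "x [^]\<^bsub>H\<^esub> k \<otimes>\<^bsub>H\<^esub> y = y \<otimes>\<^bsub>H\<^esub> inv\<^bsub>H\<^esub> x [^]\<^bsub>H\<^esub> k" for k :: nat
  proof (induction k)
    case (Suc k)
    have "x [^]\<^bsub>H\<^esub> Suc k \<otimes>\<^bsub>H\<^esub> y = x [^]\<^bsub>H\<^esub> k \<otimes>\<^bsub>H\<^esub> y \<otimes>\<^bsub>H\<^esub> inv\<^bsub>H\<^esub> x"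
      by (simp add: H.m_assoc xy1)
    also have "\<dots> = y \<otimes>\<^bsub>H\<^esub> inv\<^bsub>H\<^esub> x [^]\<^bsub>H\<^esub> Suc k"
      by (simp add: Suc.IH H.m_assoc)
    finally show ?case .
  qed simp
  have xy: "x [^]\<^bsub>H\<^esub> k \<otimes>\<^bsub>H\<^esub> y = y \<otimes>\<^bsub>H\<^esub> x [^]\<^bsub>H\<^esub> (- k)" if "k \<ge> 0" for k :: int
    using xyn[of "nat k"] that
    by (simp add: H.int_pow_neg H.int_pow_inv)
  have x_diff: "x [^]\<^bsub>H\<^esub> (- k) \<otimes>\<^bsub>H\<^esub> x [^]\<^bsub>H\<^esub> l = x [^]\<^bsub>H\<^esub> (l - k)" for k l :: int
    using H.int_pow_mult[of x "- k" l] by simp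
  define \<phi> where "\<phi> = (\<lambda>(e, k::int). (if e then y else \<one>\<^bsub>H\<^esub>) \<otimes>\<^bsub>H\<^esub> x [^]\<^bsub>H\<^esub> k)"
  have "\<phi> \<in> hom (dihedral n) H"
  proof (rule homI)
    fix u v assume "u \<in> carrier (dihedral n)" "v \<in> carrier (dihedral n)"
    then obtain e k f l where uv: "u = (e, k)" "v = (f, l)" "k \<ge> 0" by auto
    have "x [^]\<^bsub>H\<^esub> k \<otimes>\<^bsub>H\<^esub> (y \<otimes>\<^bsub>H\<^esub> x [^]\<^bsub>H\<^esub> l) = y \<otimes>\<^bsub>H\<^esub> x [^]\<^bsub>H\<^esub> (- k + l)"
      using xy[OF uv(3)] by (simp flip: H.m_assoc add: H.int_pow_mult) (simp add: H.m_assoc x_diff)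
    then show "\<phi> (u \<otimes>\<^bsub>dihedral n\<^esub> v) = \<phi> u \<otimes>\<^bsub>H\<^esub> \<phi> v"
      by (auto simp: \<phi>_def uv xn' H.int_pow_mult H.m_assoc yy' x_diff)
  qed (auto simp: \<phi>_def)
  moreover have "\<phi> (dih_a n) = x" "\<phi> dih_b = y"
    by (simp_all add: \<phi>_def dih_a_def dih_b_def xn' H.int_pow_1)
  ultimately show ?thesis by blast
qed


subsection \<open>The functions \<open>dih_chi\<close> are irreducible characters of degree two\<close>

lemma cis_period_mod:
  assumes "n \<ge> 1"
  shows "cis (2 * of_int (k mod int n) * real h * pi / real n) = cis (2 * of_int k * real h * pi / real n)"
proof -
  have "2 * of_int k * real h * pi / real n =
      2 * of_int (k mod int n) * real h * pi / real n + 2 * pi * of_int (int h * (k div int n))"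
  proof -
    have "(of_int k :: real) = of_int (int n * (k div int n) + k mod int n)" by simp
    also have "\<dots> = real n * of_int (k div int n) + of_int (k mod int n)"
      by (simp only: of_int_add of_int_mult of_int_of_nat_eq)
    finally have k: "(of_int k :: real) = real n * of_int (k div int n) + of_int (k mod int n)" .
    show ?thesis
      using assms by (subst k) (simp add: field_simps)
  qed
  moreover have "cis (2 * pi * of_int (int h * (k div int n))) = 1"
    by (rule cis_multiple_2pi) (rule Ints_of_int)
  ultimately show ?thesis
    by (simp only: cis_mult[symmetric] mult_1_right)
qed

lemma dih_chi_values:
  assumes "n \<ge> 1"
  shows "dih_chi n h (dih_a n [^]\<^bsub>dihedral n\<^esub> k) = 2 * cos (2 * real k * real h * pi / real n)"
    and "dih_chi n h (dih_b \<otimes>\<^bsub>dihedral n\<^esub> dih_a n [^]\<^bsub>dihedral n\<^esub> k) = 0"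
  using arg_cong[OF cis_period_mod[OF assms, of "int k" h], of Re] assms
  by (simp_all add: dih_a_pow dih_b_def dih_chi_def)

definition dih_rep :: "nat \<Rightarrow> nat \<Rightarrow> bool \<times> int \<Rightarrow> complex mat" where
  "dih_rep n h = (\<lambda>(e, k). let z = cis (2 * of_int k * real h * pi / real n) in
    mat 2 2 (\<lambda>(i, j). if (i = j) = e then 0 else if j = 0 then z else cnj z))"

lemma dih_rep_trace:
  "dih_rep n h x $$ (0, 0) + dih_rep n h x $$ (1, 1) = of_real (dih_chi n h x)"
  by (cases x) (auto simp: dih_rep_def dih_chi_def Let_def complex_eq_iff)

lemma dih_rep_hom:
  assumes "n \<ge> 1"
  shows "dih_rep n h (x \<otimes>\<^bsub>dihedral n\<^esub> y) = dih_rep n h x * dih_rep n h y"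
proof -
  obtain e k f l where xy: "x = (e, k)" "y = (f, l)" by (cases x; cases y)
  define Z where "Z = (\<lambda>k::int. cis (2 * of_int k * real h * pi / real n))"
  have rep: "dih_rep n h (e, k) =
      mat 2 2 (\<lambda>(i, j). if (i = j) = e then 0 else if j = 0 then Z k else cnj (Z k))" for e k
    by (simp only: dih_rep_def Z_def Let_def prod.case)
  have add: "Z (k + l) = Z k * Z l" for k l
    by (simp add: Z_def cis_mult add_divide_distrib ring_distribs)
  have uminus: "Z (- k) = cnj (Z k)" for k
    by (simp add: Z_def cis_cnj)
  have diff: "Z (l - k) = Z l * cnj (Z k)" for k l
    using add[of l "- k"] by (simp add: uminus)
  have mod: "Z (k mod int n) = Z k" for k
    unfolding Z_def by (rule cis_period_mod[OF assms])
  show ?thesis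
    by (rule eq_matI)
      (auto simp: rep xy scalar_prod_def numeral_2_eq_2 less_Suc_eq mod add uminus diff)
qed

lemma dih_rep_one: "dih_rep n h \<one>\<^bsub>dihedral n\<^esub> = 1\<^sub>m 2"
  by (rule eq_matI) (auto simp: dih_rep_def)

text \<open>A representation of degree two is irreducible iff it has no common eigenvector.\<close>

lemma dih_rep_irreducible:
  assumes "1 \<le> h" "h \<le> (n - 1) div 2" "v \<in> carrier_vec 2" "v \<noteq> 0\<^sub>v 2"
  shows "\<not> (\<forall>x\<in>carrier (dihedral n). \<exists>c. dih_rep n h x *\<^sub>v v = c \<cdot>\<^sub>v v)"
proof
  assume *: "\<forall>x\<in>carrier (dihedral n). \<exists>c. dih_rep n h x *\<^sub>v v = c \<cdot>\<^sub>v v"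
  have n: "n \<ge> 3" using assms(1,2) by linarith
  define z where "z = cis (2 * real h * pi / real n)"
  have "2 * h < n" using assms(1,2) n by linarith
  then have "2 * real h < real n" by linarith
  then have "2 * real h * pi / real n < pi" using n by (simp add: field_simps)
  moreover have "0 < 2 * real h * pi / real n" using n assms(1) by simp
  ultimately have "sin (2 * real h * pi / real n) > 0" by (rule sin_gt_zero[rotated])
  then have zz: "z \<noteq> cnj z" by (simp add: z_def complex_eq_iff)
  have v: "dim_vec v = 2" using assms(3) by simp
  from * n obtain c where "dih_rep n h (False, 1) *\<^sub>v v = c \<cdot>\<^sub>v v" by force
  then have "(dih_rep n h (False, 1) *\<^sub>v v) $ i = (c \<cdot>\<^sub>v v) $ i" for i by simp
  from this[of 0] this[of 1] have c: "z * v $ 0 = c * v $ 0" "cnj z * v $ 1 = c * v $ 1"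
    using v by (auto simp: dih_rep_def z_def Let_def scalar_prod_def numeral_2_eq_2)
  from * n obtain d where "dih_rep n h (True, 0) *\<^sub>v v = d \<cdot>\<^sub>v v" by force
  then have "(dih_rep n h (True, 0) *\<^sub>v v) $ i = (d \<cdot>\<^sub>v v) $ i" for i by simp
  from this[of 0] this[of 1] have d: "v $ 1 = d * v $ 0" "v $ 0 = d * v $ 1"
    using v by (auto simp: dih_rep_def Let_def scalar_prod_def numeral_2_eq_2)
  have "v $ 0 = 0 \<and> v $ 1 = 0"
    using c d zz by (metis mult_cancel_right mult_zero_right)
  then have "v = 0\<^sub>v 2"
    using v by (intro eq_vecI) (auto simp: numeral_2_eq_2 less_Suc_eq)
  with assms(4) show False by contradiction
qed


subsection \<open>Cayley graphs\<close>

lemma cayley_graph_simple: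
  assumes "group G" "finite (carrier G)" "S \<subseteq> carrier G - {\<one>\<^bsub>G\<^esub>}" "set_inv\<^bsub>G\<^esub> S = S"
  shows "pair_graph (cayley_graph G S)"
proof -
  interpret group G by fact
  have sym: "inv\<^bsub>G\<^esub> y \<otimes>\<^bsub>G\<^esub> x \<in> S"
    if "x \<in> carrier G" "y \<in> carrier G" "inv\<^bsub>G\<^esub> x \<otimes>\<^bsub>G\<^esub> y \<in> S" for x y
  proof -
    have "inv\<^bsub>G\<^esub> (inv\<^bsub>G\<^esub> x \<otimes>\<^bsub>G\<^esub> y) \<in> set_inv\<^bsub>G\<^esub> S" using that by (auto simp: SET_INV_def)
    with that assms(4) show ?thesis by (simp add: inv_mult_group)
  qed
  have fin: "finite (parcs (cayley_graph G S))"
    by (rule finite_subset[of _ "carrier G \<times> carrier G"]) (auto simp: cayley_graph_def assms)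
  show ?thesis
    by unfold_locales
      (use assms fin sym in \<open>auto simp: cayley_graph_def symmetric_def sym_def l_inv\<close>)
qed

end

theory Submission
  imports Defs
begin

text \<open>
  Functions on \<open>D\<^sub>n\<close> of the form \<open>a\<^sup>k \<mapsto> u \<zeta>\<^sup>h\<^sup>k\<close>, \<open>ba\<^sup>k \<mapsto> w \<zeta>\<^sup>-\<^sup>h\<^sup>k\<close> with \<open>\<zeta>\<close> a primitive \<open>n\<close>-th root of
  unity form a subspace invariant under the adjacency operator, which acts on \<open>(u, w)\<close> by a
  Hermitian matrix with rows \<open>(\<alpha>, cnj \<beta>)\<close> and \<open>(\<beta>, \<alpha>)\<close>, where \<open>\<alpha>\<close> and \<open>\<beta>\<close> are the sums of \<open>\<zeta>\<^sup>h\<^sup>k\<close>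
  over \<open>a\<^sup>k \<in> S\<^sub>1\<close> and \<open>ba\<^sup>k \<in> S\<^sub>2\<close>.  By Fourier inversion these subspaces exhaust everything, so
  the eigenvalues are \<open>\<alpha> \<plusminus> \<bar>\<beta>\<bar>\<close> for \<open>0 \<le> h < n\<close>.  The characters give
  \<open>\<chi>\<^sub>h(S\<^sub>1) = 2\<alpha>\<close>, \<open>\<chi>\<^sub>h(S\<^sub>1\<^sup>2) + \<chi>\<^sub>h(S\<^sub>2\<^sup>2) = 2\<alpha>\<^sup>2 + 2\<bar>\<beta>\<bar>\<^sup>2\<close> and \<open>\<Delta>\<^sub>h(S) = 4\<bar>\<beta>\<bar>\<^sup>2\<close>, and a parity
  argument shows that these satisfy (i) and (ii) iff \<open>\<alpha> \<plusminus> \<bar>\<beta>\<bar>\<close> are integers.  The values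
  \<open>h\<close> and \<open>n - h\<close> give the same eigenvalues, and \<open>h = 0\<close> and \<open>h = n/2\<close> always give integers.
\<close>

subsection \<open>Eigenfunctions of graphs\<close>

text \<open>Eigenvectors as functions on the vertices, free of any enumeration. Only the values on
  \<open>pverts X\<close> matter.\<close>

definition eigenfunction :: "'a pair_pre_digraph \<Rightarrow> complex \<Rightarrow> ('a \<Rightarrow> complex) \<Rightarrow> bool" where
  "eigenfunction X l f \<longleftrightarrow> (\<exists>x\<in>pverts X. f x \<noteq> 0) \<and>
    (\<forall>x\<in>pverts X. (\<Sum>y | y \<in> pverts X \<and> (x, y) \<in> parcs X. f y) = l * f x)"

lemma adjacency_matrix_mult:
  assumes "distinct vs" "set vs = pverts X" "i < length vs"
  shows "(adjacency_matrix X vs *\<^sub>v vec (length vs) (\<lambda>j. f (vs ! j))) $ i =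
    (\<Sum>y | y \<in> pverts X \<and> (vs ! i, y) \<in> parcs X. f y)"
proof -
  have "(adjacency_matrix X vs *\<^sub>v vec (length vs) (\<lambda>j. f (vs ! j))) $ i =
      (\<Sum>j<length vs. if (vs ! i, vs ! j) \<in> parcs X then f (vs ! j) else 0)"
    using assms(3)
    by (auto simp: adjacency_matrix_def scalar_prod_def atLeast0LessThan intro!: sum.cong)
  also have "\<dots> = (\<Sum>y\<in>set vs. if (vs ! i, y) \<in> parcs X then f y else 0)"
    using sum.reindex_bij_betw[OF bij_betw_nth[OF assms(1) refl refl],
        of "\<lambda>y. if (vs ! i, y) \<in> parcs X then f y else 0"] .
  also have "\<dots> = (\<Sum>y | y \<in> pverts X \<and> (vs ! i, y) \<in> parcs X. f y)"
    by (simp add: sum.If_cases assms(2)[symmetric] Int_def)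
  finally show ?thesis .
qed

text \<open>Since \<open>vs\<close> lists each vertex once, vectors and functions on the vertices
  determine each other. The right-hand side does not mention \<open>vs\<close>, so all enumerations
  give the same eigenvalues.\<close>

lemma eigenvalue_adjacency_matrix_iff:
  assumes "distinct vs" "set vs = pverts X"
  shows "eigenvalue (adjacency_matrix X vs) l \<longleftrightarrow> (\<exists>f. eigenfunction X l f)"
proof -
  let ?A = "adjacency_matrix X vs" and ?n = "length vs"
  have eigenvector_iff: "eigenvector ?A (vec ?n (\<lambda>j. f (vs ! j))) l \<longleftrightarrow> eigenfunction X l f" for f
  proof -
    have "vec ?n (\<lambda>j. f (vs ! j)) \<noteq> 0\<^sub>v ?n \<longleftrightarrow> (\<exists>x\<in>pverts X. f x \<noteq> 0)"
      unfolding assms(2)[symmetric] by (auto simp: vec_eq_iff set_conv_nth)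
    moreover have "?A *\<^sub>v vec ?n (\<lambda>j. f (vs ! j)) = l \<cdot>\<^sub>v vec ?n (\<lambda>j. f (vs ! j)) \<longleftrightarrow>
        (\<forall>i<?n. (\<Sum>y | y \<in> pverts X \<and> (vs ! i, y) \<in> parcs X. f y) = l * f (vs ! i))"
    proof -
      have "dim_vec (?A *\<^sub>v vec ?n (\<lambda>j. f (vs ! j))) = ?n"
        by (simp add: adjacency_matrix_def)
      then show ?thesis
        by (simp add: vec_eq_iff adjacency_matrix_mult[OF assms] del: index_mult_mat_vec)
    qed
    moreover have "(\<forall>i<?n. (\<Sum>y | y \<in> pverts X \<and> (vs ! i, y) \<in> parcs X. f y) = l * f (vs ! i)) \<longleftrightarrow>
        (\<forall>x\<in>pverts X. (\<Sum>y | y \<in> pverts X \<and> (x, y) \<in> parcs X. f y) = l * f x)"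
      unfolding assms(2)[symmetric] by (auto simp: set_conv_nth)
    moreover have "dim_row ?A = ?n" by (simp add: adjacency_matrix_def)
    ultimately show ?thesis
      by (simp add: eigenvector_def eigenfunction_def)
  qed
  have "\<exists>f. v = vec ?n (\<lambda>j. f (vs ! j))" if "dim_vec v = ?n" for v :: "complex vec"
  proof
    \<comment> \<open>The function is read off from \<open>v\<close> by inverting the indexing of
      \<open>vs\<close>, which is injective as \<open>vs\<close> is distinct.\<close>
    show "v = vec ?n (\<lambda>j. (\<lambda>x. v $ the_inv_into {..<?n} ((!) vs) x) (vs ! j))"
      using that assms(1)
      by (auto simp: the_inv_into_f_f inj_on_nth intro!: eq_vecI)
  qed
  moreover have "dim_vec v = ?n" if "eigenvector ?A v l" for v
    using that by (auto simp: eigenvector_def adjacency_matrix_def)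
  ultimately show ?thesis
    unfolding eigenvalue_def using eigenvector_iff by metis
qed

lemma integral_graph_iff_eigenfunction:
  assumes "finite (pverts X)"
  shows "integral_graph X \<longleftrightarrow> (\<forall>l f. eigenfunction X l f \<longrightarrow> l \<in> \<int>)"
proof -
  \<comment> \<open>At least one enumeration exists, so the quantifier in
    \<open>integral_graph\<close> is not vacuous.\<close>
  have "permutations_of_set (pverts X) \<noteq> {}"
    using assms by (simp add: permutations_of_set_nonempty)
  then show ?thesis
    using assms eigenvalue_adjacency_matrix_iff[of _ X]
    unfolding integral_graph_def permutations_of_set_def by blast
qed

text \<open>The neighbours of \<open>x\<close> are the products of \<open>x\<close> with elements of
  \<open>S\<close> on the right, so the adjacency operator is a sum of right translations.\<close>

lemma eigenfunction_cayley_graph_iff: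
  assumes "group G" "S \<subseteq> carrier G"
  shows "eigenfunction (cayley_graph G S) l f \<longleftrightarrow> (\<exists>x\<in>carrier G. f x \<noteq> 0) \<and>
    (\<forall>x\<in>carrier G. (\<Sum>s\<in>S. f (x \<otimes>\<^bsub>G\<^esub> s)) = l * f x)"
proof -
  interpret group G by fact
  have "(\<Sum>y | y \<in> carrier G \<and> inv\<^bsub>G\<^esub> x \<otimes>\<^bsub>G\<^esub> y \<in> S. f y) = (\<Sum>s\<in>S. f (x \<otimes>\<^bsub>G\<^esub> s))"
    if "x \<in> carrier G" for x
    by (rule sum.reindex_bij_witness[of _ "\<lambda>s. x \<otimes>\<^bsub>G\<^esub> s" "\<lambda>y. inv\<^bsub>G\<^esub> x \<otimes>\<^bsub>G\<^esub> y"])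
      (use that assms(2) in \<open>auto simp: m_assoc[symmetric] l_inv r_inv subset_iff\<close>)
  then show ?thesis
    by (simp add: eigenfunction_def cayley_graph_def conj_ac cong: conj_cong)
qed


subsection \<open>Roots of unity and Fourier inversion\<close>

definition unity_root :: "nat \<Rightarrow> nat \<Rightarrow> int \<Rightarrow> complex" where
  "unity_root n h k = cis (2 * of_int k * real h * pi / real n)"

lemma unity_root_mod: "n \<ge> 1 \<Longrightarrow> unity_root n h (k mod int n) = unity_root n h k"
  unfolding unity_root_def by (rule cis_period_mod)

lemma unity_root_zero [simp]: "unity_root n h 0 = 1"
  by (simp add: unity_root_def)

lemma unity_root_freq_zero [simp]: "unity_root n 0 k = 1"
  by (simp add: unity_root_def)

lemma unity_root_add: "unity_root n h (k + l) = unity_root n h k * unity_root n h l"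
  by (simp add: unity_root_def cis_mult add_divide_distrib ring_distribs)

lemma unity_root_uminus: "unity_root n h (- k) = cnj (unity_root n h k)"
  by (simp add: unity_root_def cis_cnj)

lemma unity_root_diff: "unity_root n h (k - l) = unity_root n h k * cnj (unity_root n h l)"
  using unity_root_add[of n h k "- l"] by (simp add: unity_root_uminus)

lemma unity_root_mult_cnj [simp]: "unity_root n h k * cnj (unity_root n h k) = 1"
  using unity_root_diff[of n h k k] by simp

text \<open>Modulo \<open>n\<close> the frequency \<open>n - h\<close> is \<open>- h\<close>, and
  negating the frequency conjugates the root.\<close>

lemma unity_root_freq_uminus:
  assumes "h \<le> n" "n \<ge> 1"
  shows "unity_root n (n - h) k = cnj (unity_root n h k)"
proof -
  have "unity_root n (n - h) k = cis (2 * pi * of_int k - 2 * of_int k * real h * pi / real n)"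
    using assms by (simp add: unity_root_def of_nat_diff field_simps)
  also have "\<dots> = cis (2 * pi * of_int k) / unity_root n h k"
    by (simp only: unity_root_def cis_divide)
  also have "cis (2 * pi * of_int k) = 1"
    by (rule cis_multiple_2pi) simp
  finally show ?thesis
    by (simp add: unity_root_def cis_cnj divide_inverse)
qed

text \<open>The value is \<open>cis (k * pi)\<close>, that is, 1 or -1 according to the parity of
  \<open>k\<close>.\<close>

lemma unity_root_half_Ints:
  assumes "2 * h = n" "n \<ge> 1"
  shows "unity_root n h k \<in> \<int>"
proof -
  have "real n = 2 * real h" "real h > 0" using assms by auto
  then have "unity_root n h k = cis (of_int k * pi)"
    by (simp add: unity_root_def field_simps)
  moreover have "sin (of_int k * pi) = 0"
    by (simp add: sin_zero_iff_int2)
  moreover have "cos (of_int k * pi) \<in> \<int>"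
    using cos_npi_int[of k] by (simp add: mult.commute)
  ultimately have "unity_root n h k = of_real (cos (of_int k * pi))"
    by (simp add: complex_eq_iff)
  with \<open>cos (of_int k * pi) \<in> \<int>\<close> show ?thesis
    by (auto elim!: Ints_cases)
qed

text \<open>A geometric sum over the powers of an \<open>n\<close>-th root of unity; the bound on
  \<open>k\<close> excludes ratio 1 unless \<open>k = 0\<close>.\<close>

lemma sum_unity_root:
  assumes "n \<ge> 1" "\<bar>k\<bar> < int n"
  shows "(\<Sum>h<n. unity_root n h k) = (if k = 0 then of_nat n else 0)"
proof (cases "k = 0")
  case False
  define z where "z = cis (2 * of_int k * pi / real n)"
  have pow: "unity_root n h k = z ^ h" for h
    by (simp add: unity_root_def z_def DeMoivre mult_ac)
  have "z \<noteq> 1"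
  proof
    assume "z = 1"
    then have "cos (2 * of_int k * pi / real n) = 1"
      by (simp add: z_def complex_eq_iff)
    then obtain i :: int where "2 * of_int k * pi / real n = of_int i * 2 * pi"
      by (auto simp: cos_one_2pi_int)
    then have "(of_int k :: real) = of_int (i * int n)"
      using assms(1) by (simp add: field_simps)
    then have "int n dvd k" by (simp only: of_int_eq_iff) simp
    from dvd_imp_le_int[OF False this] assms(2) show False by simp
  qed
  \<comment> \<open>Frequency \<open>n\<close> is the mirror image of frequency 0, where the root is
    1.\<close>
  moreover have "z ^ n = 1"
    using unity_root_freq_uminus[of 0 n k] assms(1) by (simp flip: pow)
  ultimately show ?thesis
    using False by (simp add: pow geometric_sum)
qed simp

text \<open>Weighting the coefficient at \<open>h\<close> by the root at \<open>- j\<close> and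
  summing over \<open>h\<close> leaves, by orthogonality, \<open>n\<close> times
  \<open>f j\<close>.\<close>

lemma fourier_eq_zero:
  fixes f :: "int \<Rightarrow> complex"
  assumes "n \<ge> 1" "j \<in> {0..<int n}"
    and zero: "\<And>h. h < n \<Longrightarrow> (\<Sum>k\<in>{0..<int n}. f k * unity_root n h k) = 0"
  shows "f j = 0"
proof -
  have "0 = (\<Sum>h<n. (\<Sum>k\<in>{0..<int n}. f k * unity_root n h k) * unity_root n h (- j))"
    by (simp add: zero)
  also have "\<dots> = (\<Sum>h<n. \<Sum>k\<in>{0..<int n}. f k * unity_root n h (k - j))"
    by (simp add: sum_distrib_right unity_root_diff unity_root_uminus mult.assoc)
  also have "\<dots> = (\<Sum>k\<in>{0..<int n}. f k * (\<Sum>h<n. unity_root n h (k - j)))"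
    by (subst sum.swap) (simp add: sum_distrib_left)
  also have "\<dots> = (\<Sum>k\<in>{0..<int n}. if k = j then f j * of_nat n else 0)"
    by (rule sum.cong) (use assms(1,2) in \<open>auto simp: sum_unity_root\<close>)
  also have "\<dots> = f j * of_nat n"
    using assms(2) by simp
  finally show ?thesis using assms(1) by simp
qed

lemma sum_mod_shift:
  fixes f :: "int \<Rightarrow> complex"
  assumes "n \<ge> 1"
  shows "(\<Sum>k\<in>{0..<int n}. f ((k + s) mod int n)) = (\<Sum>k\<in>{0..<int n}. f k)"
  by (rule sum.reindex_bij_witness[of _ "\<lambda>k. (k - s) mod int n" "\<lambda>k. (k + s) mod int n"])
    (use assms in \<open>auto simp: mod_simps\<close>)

lemma sum_mod_reflect:
  fixes f :: "int \<Rightarrow> complex"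
  assumes "n \<ge> 1"
  shows "(\<Sum>k\<in>{0..<int n}. f ((s - k) mod int n)) = (\<Sum>k\<in>{0..<int n}. f k)"
  by (rule sum.reindex_bij_witness[of _ "\<lambda>k. (s - k) mod int n" "\<lambda>k. (s - k) mod int n"])
    (use assms in \<open>auto simp: mod_simps\<close>)

lemma sum_shift_unity_root:
  assumes "n \<ge> 1"
  shows "(\<Sum>k\<in>{0..<int n}. g ((k + s) mod int n) * unity_root n h k) =
    cnj (unity_root n h s) * (\<Sum>k\<in>{0..<int n}. g k * unity_root n h k)"
proof -
  have "unity_root n h k = cnj (unity_root n h s) * unity_root n h ((k + s) mod int n)" for k
    using assms unity_root_mult_cnj[of n h s] by (simp add: unity_root_mod unity_root_add mult_ac)
  then have "(\<Sum>k\<in>{0..<int n}. g ((k + s) mod int n) * unity_root n h k) =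
    (\<Sum>k\<in>{0..<int n}. (\<lambda>j. cnj (unity_root n h s) * (g j * unity_root n h j)) ((k + s) mod int n))"
    by (intro sum.cong refl) (metis mult.left_commute)
  also have "\<dots> = (\<Sum>k\<in>{0..<int n}. cnj (unity_root n h s) * (g k * unity_root n h k))"
    by (rule sum_mod_shift[OF assms])
  finally show ?thesis by (simp add: sum_distrib_left)
qed

text \<open>Reflecting the argument turns a coefficient into the one at the opposite frequency. This
  describes right multiplication by a reflection, which negates the exponent of
  \<open>a\<close>.\<close>

lemma sum_reflect_unity_root:
  assumes "n \<ge> 1"
  shows "(\<Sum>k\<in>{0..<int n}. g ((- k + s) mod int n) * unity_root n h k) =
    unity_root n h s * (\<Sum>k\<in>{0..<int n}. g k * cnj (unity_root n h k))"
proof -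
  have "unity_root n h k = unity_root n h s * cnj (unity_root n h ((s - k) mod int n))" for k
    using assms unity_root_mult_cnj[of n h s] by (simp add: unity_root_mod unity_root_diff)
  then have "(\<Sum>k\<in>{0..<int n}. g ((- k + s) mod int n) * unity_root n h k) =
    (\<Sum>k\<in>{0..<int n}. (\<lambda>j. unity_root n h s * (g j * cnj (unity_root n h j))) ((s - k) mod int n))"
    by (intro sum.cong refl) (metis mult.left_commute uminus_add_conv_diff)
  also have "\<dots> = (\<Sum>k\<in>{0..<int n}. unity_root n h s * (g k * cnj (unity_root n h k)))"
    by (rule sum_mod_reflect[OF assms])
  finally show ?thesis by (simp add: sum_distrib_left)
qed


subsection \<open>The spectrum of a Cayley graph of the dihedral group\<close>

text \<open>On \<open>S1\<close> and \<open>S2\<close> this gives the entries \<alpha> and \<beta>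
  of the block at frequency \<open>h\<close>. Only the exponent of \<open>a\<close> enters, so one
  definition serves rotations and reflections.\<close>

definition root_sum :: "nat \<Rightarrow> nat \<Rightarrow> (bool \<times> int) set \<Rightarrow> complex" where
  "root_sum n h A = (\<Sum>x\<in>A. unity_root n h (snd x))"

section \<open>Eigenvalues of the two-by-two blocks\<close>

lemma eigenvector_2x2_exists:
  fixes \<alpha> \<beta> l :: complex
  assumes "(l - \<alpha>)\<^sup>2 = \<beta> * cnj \<beta>"
  obtains u w where "u \<noteq> 0 \<or> w \<noteq> 0" "\<alpha> * u + cnj \<beta> * w = l * u" "\<beta> * u + \<alpha> * w = l * w"
proof (cases "\<beta> = 0")
  case True
  with assms show ?thesis by (intro that[of 1 0]) auto
next
  case False
  with assms show ?thesis
    \<comment> \<open>The second equation holds identically for this vector; the first is then the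
      characteristic equation.\<close>
    by (intro that[of "l - \<alpha>" \<beta>]) (auto simp: power2_eq_square algebra_simps)
qed

text \<open>Substituting one equation into the other shows that
  \<open>(l - \<alpha>)\<^sup>2 - \<beta> * cnj \<beta>\<close> annihilates both \<open>u\<close>
  and \<open>w\<close>, one of which is nonzero.\<close>

lemma eigenvalue_2x2_root:
  fixes \<alpha> \<beta> l u w :: complex
  assumes "u \<noteq> 0 \<or> w \<noteq> 0" "\<alpha> * u + cnj \<beta> * w = l * u" "\<beta> * u + \<alpha> * w = l * w"
  shows "(l - \<alpha>)\<^sup>2 = \<beta> * cnj \<beta>"
proof -
  have 1: "cnj \<beta> * w = (l - \<alpha>) * u" and 2: "\<beta> * u = (l - \<alpha>) * w"
    using assms(2,3) by (auto simp: algebra_simps)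
  have "(l - \<alpha>)\<^sup>2 * u = (l - \<alpha>) * (cnj \<beta> * w)" by (simp only: 1 power2_eq_square mult.assoc)
  also have "\<dots> = \<beta> * cnj \<beta> * u" using 2 by (metis mult.left_commute mult.assoc)
  finally have "((l - \<alpha>)\<^sup>2 - \<beta> * cnj \<beta>) * u = 0" by (simp add: left_diff_distrib)
  moreover have "(l - \<alpha>)\<^sup>2 * w = (l - \<alpha>) * (\<beta> * u)" by (simp only: 2 power2_eq_square mult.assoc)
  then have "(l - \<alpha>)\<^sup>2 * w = \<beta> * cnj \<beta> * w" using 1 by (metis mult.left_commute mult.assoc)
  then have "((l - \<alpha>)\<^sup>2 - \<beta> * cnj \<beta>) * w = 0" by (simp add: left_diff_distrib)
  ultimately show ?thesis using assms(1) by auto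
qed

section \<open>The block decomposition of the adjacency operator\<close>

text \<open>The connection set in coordinates. Closure under inversion becomes negation of exponents
  on \<open>S1\<close>; a reflection is its own inverse.\<close>

locale dihedral_connection =
  fixes n :: nat and S1 S2 :: "(bool \<times> int) set"
  assumes n: "n \<ge> 1"
    and S1: "S1 \<subseteq> {False} \<times> {0..<int n}"
    and S2: "S2 \<subseteq> {True} \<times> {0..<int n}"
    and S1_inv: "(False, k) \<in> S1 \<Longrightarrow> (False, - k mod int n) \<in> S1"
begin

lemma finite_S1: "finite S1" and finite_S2: "finite S2"
  by (rule finite_subset[OF S1], simp) (rule finite_subset[OF S2], simp)

lemma S1_eq: "x \<in> S1 \<Longrightarrow> (False, snd x) = x" and S2_eq: "x \<in> S2 \<Longrightarrow> (True, snd x) = x"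
  using S1 S2 by (auto simp: prod_eq_iff)

lemma sum_S:
  fixes g :: "bool \<times> int \<Rightarrow> 'b::comm_monoid_add"
  shows "(\<Sum>s\<in>S1 \<union> S2. g s) = (\<Sum>s\<in>S1. g (False, snd s)) + (\<Sum>s\<in>S2. g (True, snd s))"
proof -
  have "(\<Sum>s\<in>S1 \<union> S2. g s) = (\<Sum>s\<in>S1. g s) + (\<Sum>s\<in>S2. g s)"
    using S1 S2 finite_S1 finite_S2 by (intro sum.union_disjoint) auto
  moreover have "(\<Sum>s\<in>S1. g s) = (\<Sum>s\<in>S1. g (False, snd s))"
    by (simp add: S1_eq)
  moreover have "(\<Sum>s\<in>S2. g s) = (\<Sum>s\<in>S2. g (True, snd s))"
    by (simp add: S2_eq)
  ultimately show ?thesis by simp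
qed

text \<open>Conjugation negates the exponents, and negation permutes \<open>S1\<close>.\<close>

lemma cnj_root_sum_S1: "cnj (root_sum n h S1) = root_sum n h S1"
proof -
  have mem: "(False, - snd x mod int n) \<in> S1" if "x \<in> S1" for x
    using S1_inv[of "snd x"] S1_eq[OF that] that by simp
  have idem: "(False, - (- snd x mod int n) mod int n) = x" if "x \<in> S1" for x
    using S1_eq[OF that] that S1 by (auto simp: mod_simps)
  have "root_sum n h S1 = (\<Sum>x\<in>S1. cnj (unity_root n h (snd x)))"
    unfolding root_sum_def
    by (rule sum.reindex_bij_witness[of _ "\<lambda>x. (False, - snd x mod int n)"
          "\<lambda>x. (False, - snd x mod int n)"])
      (simp_all add: mem idem unity_root_mod[OF n] unity_root_uminus)
  then show ?thesis by (simp add: root_sum_def)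
qed

lemma root_sum_S1_real: "root_sum n h S1 = of_real (Re (root_sum n h S1))"
  using cnj_root_sum_S1[of h] by (simp add: complex_eq_iff)

text \<open>At each frequency the Fourier coefficients of \<open>f\<close> on the two cosets satisfy
  the block's eigenvalue equations. By Fourier inversion they cannot vanish at every
  frequency.\<close>

lemma eigenfunction_imp_root:
  assumes "\<exists>x\<in>carrier (dihedral n). f x \<noteq> 0"
    and eig: "\<And>x. x \<in> carrier (dihedral n) \<Longrightarrow> (\<Sum>s\<in>S1 \<union> S2. f (x \<otimes>\<^bsub>dihedral n\<^esub> s)) = l * f x"
  shows "\<exists>h<n. (l - root_sum n h S1)\<^sup>2 = root_sum n h S2 * cnj (root_sum n h S2)"
proof -
  \<comment> \<open>The cosets are expanded with opposite signs of the frequency: as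
    \<open>(e, k)\<close> times \<open>(True, s)\<close> has exponent \<open>s - k\<close>, this
    keeps the equations within a single \<open>h\<close>.\<close>
  define u where "u h = (\<Sum>k\<in>{0..<int n}. f (False, k) * cnj (unity_root n h k))" for h
  define w where "w h = (\<Sum>k\<in>{0..<int n}. f (True, k) * unity_root n h k)" for h
  \<comment> \<open>The transform rules for conjugate roots come from applying those for plain roots
    to the conjugate of \<open>f\<close> and conjugating the result.\<close>
  have shift: "(\<Sum>k\<in>{0..<int n}. f (e, (k + s) mod int n) * cnj (unity_root n h k)) =
      unity_root n h s * (\<Sum>k\<in>{0..<int n}. f (e, k) * cnj (unity_root n h k))" for e s h
    using arg_cong[OF sum_shift_unity_root[OF n, of "\<lambda>k. cnj (f (e, k))" s h], of cnj]
    by simp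
  have reflect: "(\<Sum>k\<in>{0..<int n}. f (e, (- k + s) mod int n) * cnj (unity_root n h k)) =
      cnj (unity_root n h s) * (\<Sum>k\<in>{0..<int n}. f (e, k) * unity_root n h k)" for e s h
    using arg_cong[OF sum_reflect_unity_root[OF n, of "\<lambda>k. cnj (f (e, k))" s h], of cnj]
    by simp
  have F: "l * f (False, k) = (\<Sum>s\<in>S1. f (False, (k + snd s) mod int n)) +
      (\<Sum>s\<in>S2. f (True, (- k + snd s) mod int n))" if "k \<in> {0..<int n}" for k
    using eig[of "(False, k)"] that by (simp add: sum_S)
  have T: "l * f (True, k) = (\<Sum>s\<in>S1. f (True, (k + snd s) mod int n)) +
      (\<Sum>s\<in>S2. f (False, (- k + snd s) mod int n))" if "k \<in> {0..<int n}" for k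
    using eig[of "(True, k)"] that by (simp add: sum_S)
  have lu: "root_sum n h S1 * u h + cnj (root_sum n h S2) * w h = l * u h" for h
  proof -
    have "l * u h = (\<Sum>k\<in>{0..<int n}. (l * f (False, k)) * cnj (unity_root n h k))"
      by (simp add: u_def sum_distrib_left mult_ac)
    also have "\<dots> = (\<Sum>k\<in>{0..<int n}. \<Sum>s\<in>S1. f (False, (k + snd s) mod int n) * cnj (unity_root n h k))
        + (\<Sum>k\<in>{0..<int n}. \<Sum>s\<in>S2. f (True, (- k + snd s) mod int n) * cnj (unity_root n h k))"
      unfolding sum.distrib[symmetric]
      by (intro sum.cong refl) (simp only: F sum_distrib_right ring_distribs)
    also have "\<dots> = root_sum n h S1 * u h + cnj (root_sum n h S2) * w h"
      unfolding sum.swap[where A = "{0..<int n}"] shift reflect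
      by (simp add: root_sum_def u_def w_def sum_distrib_right)
    finally show ?thesis by simp
  qed
  have lw: "root_sum n h S2 * u h + root_sum n h S1 * w h = l * w h" for h
  proof -
    have "l * w h = (\<Sum>k\<in>{0..<int n}. (l * f (True, k)) * unity_root n h k)"
      by (simp add: w_def sum_distrib_left mult_ac)
    also have "\<dots> = (\<Sum>k\<in>{0..<int n}. \<Sum>s\<in>S1. f (True, (k + snd s) mod int n) * unity_root n h k)
        + (\<Sum>k\<in>{0..<int n}. \<Sum>s\<in>S2. f (False, (- k + snd s) mod int n) * unity_root n h k)"
      unfolding sum.distrib[symmetric]
      by (intro sum.cong refl) (simp only: T sum_distrib_right ring_distribs)
    also have "\<dots> = cnj (root_sum n h S1) * w h + root_sum n h S2 * u h"
      unfolding sum.swap[where A = "{0..<int n}"]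
        sum_shift_unity_root[OF n, of "\<lambda>k. f (_, k)"] sum_reflect_unity_root[OF n, of "\<lambda>k. f (_, k)"]
      by (simp add: root_sum_def u_def w_def sum_distrib_right)
    \<comment> \<open>The opposite sign on the reflections produces the conjugate of \<alpha>, which
      is \<alpha> itself.\<close>
    finally show ?thesis by (simp add: cnj_root_sum_S1)
  qed
  have "\<exists>h<n. u h \<noteq> 0 \<or> w h \<noteq> 0"
  proof (rule ccontr)
    assume "\<not> ?thesis"
    then have zero: "u h = 0" "w h = 0" if "h < n" for h using that by auto
    have "(\<Sum>k\<in>{0..<int n}. cnj (f (False, k)) * unity_root n h k) = 0" if "h < n" for h
      using arg_cong[OF zero(1)[OF that], of cnj] by (simp add: u_def)
    then have "f (False, k) = 0" if "k \<in> {0..<int n}" for k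
      using fourier_eq_zero[OF n that, of "\<lambda>k. cnj (f (False, k))"] by simp
    moreover have "f (True, k) = 0" if "k \<in> {0..<int n}" for k
      using fourier_eq_zero[OF n that, of "\<lambda>k. f (True, k)"] zero(2) by (simp add: w_def)
    ultimately have "f x = 0" if "x \<in> carrier (dihedral n)" for x
      using that by (cases x; cases "fst x") auto
    with assms(1) show False by blast
  qed
  then obtain h where h: "h < n" "u h \<noteq> 0 \<or> w h \<noteq> 0" by blast
  with eigenvalue_2x2_root[OF h(2) lu lw] show ?thesis by blast
qed

text \<open>An eigenvector \<open>(u, w)\<close> of the block spreads to the function of the
  overview, whose values at the identity and at \<open>dih_b\<close> are \<open>u\<close> and
  \<open>w\<close>.\<close>

lemma root_imp_eigenfunction:
  assumes "(l - root_sum n h S1)\<^sup>2 = root_sum n h S2 * cnj (root_sum n h S2)"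
  obtains f where "\<exists>x\<in>carrier (dihedral n). f x \<noteq> 0"
    and "\<And>x. x \<in> carrier (dihedral n) \<Longrightarrow> (\<Sum>s\<in>S1 \<union> S2. f (x \<otimes>\<^bsub>dihedral n\<^esub> s)) = l * f x"
proof -
  obtain u w where uw: "u \<noteq> 0 \<or> w \<noteq> 0"
    "root_sum n h S1 * u + cnj (root_sum n h S2) * w = l * u"
    "root_sum n h S2 * u + root_sum n h S1 * w = l * w"
    using eigenvector_2x2_exists[OF assms] .
  define f where "f = (\<lambda>(e, k). if e then w * cnj (unity_root n h k) else u * unity_root n h k)"
  show ?thesis
  proof
    have "f (False, 0) \<noteq> 0 \<or> f (True, 0) \<noteq> 0" using uw(1) by (simp add: f_def)
    moreover have "(e, 0) \<in> carrier (dihedral n)" for e using n by simp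
    ultimately show "\<exists>x\<in>carrier (dihedral n). f x \<noteq> 0" by blast
  next
    fix x assume "x \<in> carrier (dihedral n)"
    obtain e k where x: "x = (e, k)" by (cases x)
    have "(\<Sum>s\<in>S1 \<union> S2. f ((False, k) \<otimes>\<^bsub>dihedral n\<^esub> s)) =
        (root_sum n h S1 * u + cnj (root_sum n h S2) * w) * unity_root n h k"
      unfolding sum_S
      by (simp add: f_def unity_root_mod[OF n] unity_root_add unity_root_diff unity_root_uminus
          root_sum_def sum_distrib_left sum_distrib_right mult_ac ring_distribs)
    moreover have "(\<Sum>s\<in>S1 \<union> S2. f ((True, k) \<otimes>\<^bsub>dihedral n\<^esub> s)) =
        (root_sum n h S2 * u + cnj (root_sum n h S1) * w) * cnj (unity_root n h k)"
      unfolding sum_S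
      by (simp add: f_def unity_root_mod[OF n] unity_root_add unity_root_diff unity_root_uminus
          root_sum_def sum_distrib_left sum_distrib_right mult_ac ring_distribs)
    ultimately show "(\<Sum>s\<in>S1 \<union> S2. f (x \<otimes>\<^bsub>dihedral n\<^esub> s)) = l * f x"
      using uw(2,3) by (cases e) (simp_all add: x cnj_root_sum_S1 f_def mult.assoc)
  qed
qed

section \<open>Explicit real eigenvalues\<close>

text \<open>Taking the real part loses nothing, since the sum over \<open>S1\<close> is
  real.\<close>

definition alpha :: "nat \<Rightarrow> real" where "alpha h = Re (root_sum n h S1)"

text \<open>The modulus suffices, because the characteristic equation involves \<beta> only through
  the product with its conjugate.\<close>

definition beta :: "nat \<Rightarrow> real" where "beta h = cmod (root_sum n h S2)"

lemma root_iff: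
  "(l - root_sum n h S1)\<^sup>2 = root_sum n h S2 * cnj (root_sum n h S2) \<longleftrightarrow>
    l = of_real (alpha h + beta h) \<or> l = of_real (alpha h - beta h)"
proof -
  have "(l - root_sum n h S1)\<^sup>2 = root_sum n h S2 * cnj (root_sum n h S2) \<longleftrightarrow>
      (l - of_real (alpha h))\<^sup>2 = (of_real (beta h))\<^sup>2"
    by (subst root_sum_S1_real)
      (simp add: alpha_def beta_def flip: complex_norm_square)
  also have "\<dots> \<longleftrightarrow> l = of_real (alpha h + beta h) \<or> l = of_real (alpha h - beta h)"
    unfolding power2_eq_iff by (auto simp: algebra_simps)
  finally show ?thesis .
qed

lemma integral_iff:
  "integral_graph (cayley_graph (dihedral n) (S1 \<union> S2)) \<longleftrightarrow>
    (\<forall>h<n. alpha h + beta h \<in> \<int> \<and> alpha h - beta h \<in> \<int>)"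
proof -
  have fin: "finite (pverts (cayley_graph (dihedral n) (S1 \<union> S2)))"
    by (simp add: cayley_graph_def)
  have sub: "S1 \<union> S2 \<subseteq> carrier (dihedral n)" using S1 S2 by auto
  note eigenfunction_iff = eigenfunction_cayley_graph_iff[OF dihedral_group[OF n] sub]
  have "(\<exists>f. eigenfunction (cayley_graph (dihedral n) (S1 \<union> S2)) l f) \<longleftrightarrow>
      (\<exists>h<n. l = of_real (alpha h + beta h) \<or> l = of_real (alpha h - beta h))" (is "?L l \<longleftrightarrow> ?R l") for l
  proof
    assume "?L l"
    then show "?R l"
      unfolding eigenfunction_iff using eigenfunction_imp_root root_iff by blast
  next
    assume "?R l"
    then obtain h where "(l - root_sum n h S1)\<^sup>2 = root_sum n h S2 * cnj (root_sum n h S2)"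
      using root_iff by blast
    from root_imp_eigenfunction[OF this] show "?L l"
      unfolding eigenfunction_iff by metis
  qed
  then have "integral_graph (cayley_graph (dihedral n) (S1 \<union> S2)) \<longleftrightarrow>
      (\<forall>l::complex. (\<exists>h<n. l = of_real (alpha h + beta h) \<or> l = of_real (alpha h - beta h)) \<longrightarrow> l \<in> \<int>)"
    by (simp only: integral_graph_iff_eigenfunction[OF fin] all_simps)
  also have "\<dots> \<longleftrightarrow>
      (\<forall>h<n. complex_of_real (alpha h + beta h) \<in> \<int> \<and> complex_of_real (alpha h - beta h) \<in> \<int>)"
    by auto
  also have "\<dots> \<longleftrightarrow> (\<forall>h<n. alpha h + beta h \<in> \<int> \<and> alpha h - beta h \<in> \<int>)"
  proof -
    have "complex_of_real r \<in> \<int> \<longleftrightarrow> r \<in> \<int>" for r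
      by (metis Ints_cases Ints_of_int of_real_eq_iff of_real_of_int_eq)
    then show ?thesis by (simp only:)
  qed
  finally show ?thesis .
qed

section \<open>Character sums in terms of \<open>alpha\<close> and \<open>beta\<close>\<close>

lemma chi_sum_S1: "chi_sum n h S1 = 2 * alpha h"
  unfolding chi_sum_def alpha_def root_sum_def Re_sum sum_distrib_left
  by (rule sum.cong) (use S1 in \<open>auto simp: dih_chi_def unity_root_def\<close>)

lemma dih_chi_rotation: "dih_chi n h (False, k mod int n) = 2 * Re (unity_root n h k)"
  using unity_root_mod[OF n, of h k] by (simp add: dih_chi_def unity_root_def complex_eq_iff)

lemma chi_sum_sq_S1: "chi_sum_sq n h S1 = 2 * (alpha h)\<^sup>2"
proof -
  have "dih_chi n h (x \<otimes>\<^bsub>dihedral n\<^esub> y) = 2 * Re (unity_root n h (snd x) * unity_root n h (snd y))"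
    if "x \<in> S1" "y \<in> S1" for x y
    using dihedral_simps(3)[of n False "snd x" False "snd y"]
    by (simp add: S1_eq that dih_chi_rotation unity_root_add)
  then have "chi_sum_sq n h S1 = (\<Sum>x\<in>S1. \<Sum>y\<in>S1. 2 * Re (unity_root n h (snd x) * unity_root n h (snd y)))"
    by (simp only: chi_sum_sq_def cong: sum.cong)
  also have "\<dots> = 2 * Re (root_sum n h S1 * root_sum n h S1)"
    unfolding root_sum_def sum_product unfolding Re_sum sum_distrib_left ..
  also have "\<dots> = 2 * (alpha h)\<^sup>2"
    by (subst (1 2) root_sum_S1_real) (simp add: alpha_def power2_eq_square)
  finally show ?thesis .
qed

text \<open>The product of the reflections with exponents \<open>k\<close> and \<open>l\<close> is
  the rotation with exponent \<open>l - k\<close>, so the double sum factors into a root sum times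
  its conjugate.\<close>

lemma chi_sum_sq_S2: "chi_sum_sq n h S2 = 2 * (beta h)\<^sup>2"
proof -
  have "dih_chi n h (x \<otimes>\<^bsub>dihedral n\<^esub> y) =
      2 * Re (cnj (unity_root n h (snd x)) * unity_root n h (snd y))"
    if "x \<in> S2" "y \<in> S2" for x y
    using dihedral_simps(3)[of n True "snd x" True "snd y"]
    by (simp add: S2_eq that dih_chi_rotation unity_root_diff)
  then have "chi_sum_sq n h S2 =
      (\<Sum>x\<in>S2. \<Sum>y\<in>S2. 2 * Re (cnj (unity_root n h (snd x)) * unity_root n h (snd y)))"
    by (simp only: chi_sum_sq_def cong: sum.cong)
  also have "\<dots> = 2 * Re (cnj (root_sum n h S2) * root_sum n h S2)"
    unfolding root_sum_def cnj_sum sum_product unfolding Re_sum sum_distrib_left ..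
  also have "cnj (root_sum n h S2) * root_sum n h S2 = of_real ((beta h)\<^sup>2)"
    unfolding beta_def complex_norm_square by (rule mult.commute)
  finally show ?thesis by simp
qed

text \<open>The \<open>alpha\<close> terms cancel. What remains is the squared difference of the two
  eigenvalues of the block.\<close>

lemma Delta_eq: "Delta n h S1 S2 = (2 * beta h)\<^sup>2"
  by (simp add: Delta_def chi_sum_S1 chi_sum_sq_S1 chi_sum_sq_S2 power2_eq_square algebra_simps)

section \<open>Reduction to frequencies below \<open>n / 2\<close>\<close>

lemma root_sum_freq_uminus:
  assumes "h \<le> n"
  shows "root_sum n (n - h) A = cnj (root_sum n h A)"
  by (simp add: root_sum_def unity_root_freq_uminus[OF assms n])

lemma alpha_beta_freq_uminus:
  assumes "h \<le> n"
  shows "alpha (n - h) = alpha h" "beta (n - h) = beta h"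
  by (simp_all add: alpha_def beta_def root_sum_freq_uminus[OF assms])

lemma alpha_beta_Ints:
  assumes "\<And>k. unity_root n h k \<in> \<int>"
  shows "alpha h \<in> \<int>" "beta h \<in> \<int>"
proof -
  have "root_sum n h A \<in> \<int>" for A
    unfolding root_sum_def using assms by (intro Ints_sum)
  then obtain i j where "root_sum n h S1 = of_int i" "root_sum n h S2 = of_int j"
    by (metis Ints_cases)
  then show "alpha h \<in> \<int>" "beta h \<in> \<int>"
    by (simp_all add: alpha_def beta_def)
qed

lemma integral_iff_half:
  "integral_graph (cayley_graph (dihedral n) (S1 \<union> S2)) \<longleftrightarrow>
    (\<forall>h. 1 \<le> h \<and> h \<le> (n - 1) div 2 \<longrightarrow> alpha h + beta h \<in> \<int> \<and> alpha h - beta h \<in> \<int>)"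
proof -
  have "alpha h + beta h \<in> \<int> \<and> alpha h - beta h \<in> \<int>"
    if half: "\<forall>h. 1 \<le> h \<and> h \<le> (n - 1) div 2 \<longrightarrow> alpha h + beta h \<in> \<int> \<and> alpha h - beta h \<in> \<int>"
      and h: "h < n" for h
  proof -
    \<comment> \<open>At 0 and at the midpoint, present for even \<open>n\<close>, the roots are
      integers; any other frequency or its mirror image lies in the lower half.\<close>
    consider "h = 0" | "2 * h = n" | "1 \<le> h" "h \<le> (n - 1) div 2"
      | "1 \<le> n - h" "n - h \<le> (n - 1) div 2"
      using h by linarith
    then show ?thesis
    proof cases
      case 1
      then show ?thesis using alpha_beta_Ints[of h] by simp
    next
      case 2
      then show ?thesis using alpha_beta_Ints[OF unity_root_half_Ints[OF _ n]] by simp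
    next
      case 3
      with half show ?thesis by blast
    next
      case 4
      with half have "alpha (n - h) + beta (n - h) \<in> \<int> \<and> alpha (n - h) - beta (n - h) \<in> \<int>"
        by blast
      with h show ?thesis by (simp add: alpha_beta_freq_uminus)
    qed
  qed
  moreover have "h < n" if "h \<le> (n - 1) div 2" for h
    using n that by linarith
  ultimately show ?thesis unfolding integral_iff by blast
qed

end

section \<open>Integrality as a parity condition\<close>

text \<open>Conditions (i) and (ii) make \<open>2 * a\<close> and \<open>2 * b\<close> integers.
  Doubling the integer \<open>2 * a\<^sup>2 + 2 * b\<^sup>2\<close> shows that their squares have an
  even sum, so they have equal parity and half their sum and half their difference are
  integers.\<close>

lemma sum_diff_Ints_iff:
  fixes a b :: real
  shows "a + b \<in> \<int> \<and> a - b \<in> \<int> \<longleftrightarrow>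
    (2 * a \<in> \<int> \<and> 2 * a\<^sup>2 + 2 * b\<^sup>2 \<in> \<int>) \<and> is_square_number ((2 * b)\<^sup>2)"
    (is "?L \<longleftrightarrow> ?R")
proof
  assume ?L
  then obtain p q where pq: "a + b = of_int p" "a - b = of_int q"
    by (auto elim!: Ints_cases)
  have "2 * a = of_int (p + q)" "2 * b = of_int (p - q)"
    using pq by simp_all
  moreover have "2 * a\<^sup>2 + 2 * b\<^sup>2 = of_int (p\<^sup>2 + q\<^sup>2)"
    by (simp flip: pq add: power2_eq_square algebra_simps)
  ultimately show ?R
    by (metis Ints_of_int is_square_number_def of_int_power)
next
  assume ?R
  then obtain p r w where p: "2 * a = of_int p" and r: "2 * a\<^sup>2 + 2 * b\<^sup>2 = of_int r"
    and w: "(2 * b)\<^sup>2 = of_int (w\<^sup>2)"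
    by (auto simp: is_square_number_def elim!: Ints_cases)
  have "(of_int (p\<^sup>2 + w\<^sup>2) :: real) = (2 * a)\<^sup>2 + (2 * b)\<^sup>2"
    using p w by simp
  also have "\<dots> = of_int (2 * r)"
    by (simp flip: r add: power_mult_distrib)
  finally have "(of_int (p\<^sup>2 + w\<^sup>2) :: real) = of_int (2 * r)" .
  then have "p\<^sup>2 + w\<^sup>2 = 2 * r" by (simp only: of_int_eq_iff)
  then have "even (p\<^sup>2 + w\<^sup>2)" by simp
  then have "even (p + w)" "even (p - w)" by auto
  then obtain i j where ij: "p + w = 2 * i" "p - w = 2 * j" unfolding dvd_def by blast
  have i: "of_int p + of_int w = 2 * (of_int i :: real)" and j: "of_int p - of_int w = 2 * (of_int j :: real)"
    using arg_cong[OF ij(1), of real_of_int] arg_cong[OF ij(2), of real_of_int] by simp_all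
  have "(2 * b)\<^sup>2 = (of_int w)\<^sup>2" using w by simp
  then have "2 * b = of_int w \<or> 2 * b = - of_int w" by (simp only: power2_eq_iff)
  \<comment> \<open>The square determines \<open>2 * b\<close> only up to sign; the other sign
    exchanges the two values.\<close>
  then have "(a + b = of_int i \<and> a - b = of_int j) \<or> (a + b = of_int j \<and> a - b = of_int i)"
    using p i j by auto
  then show ?L by (metis Ints_of_int)
qed

section \<open>From subsets of the group to coordinates\<close>

lemma dihedral_inv_rotation:
  assumes "n \<ge> 1" "k \<in> {0..<int n}"
  shows "inv\<^bsub>dihedral n\<^esub> (False, k) = (False, - k mod int n)"
  using assms by (intro group.inv_equality[OF dihedral_group]) (auto simp: mod_simps)

lemma fst_dihedral_mult: "fst (x \<otimes>\<^bsub>dihedral n\<^esub> y) \<longleftrightarrow> fst x \<noteq> fst y"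
  by (cases x; cases y) simp

lemma generate_rotation:
  assumes "n \<ge> 1" "x \<in> generate (dihedral n) {dih_a n}"
  shows "\<not> fst x"
  using assms(2)
proof (induction rule: generate.induct)
  case (inv x)
  then show ?case using assms(1) by (simp add: dih_a_def dihedral_inv_rotation)
next
  case (eng x y)
  then show ?case by (simp add: fst_dihedral_mult)
qed (simp_all add: dih_a_def)

theorem theorem2p2:
  fixes n :: nat and S S1 S2 :: "(bool \<times> int) set"
  assumes "n \<ge> 1"
    and "S = S1 \<union> S2"
    and "S \<subseteq> carrier (dihedral n) - {\<one>\<^bsub>dihedral n\<^esub>}"
    and "set_inv\<^bsub>dihedral n\<^esub> S = S"
    and "S1 \<subseteq> generate (dihedral n) {dih_a n}"
    and "S2 \<subseteq> dih_b <#\<^bsub>dihedral n\<^esub> generate (dihedral n) {dih_a n}"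
  shows "integral_graph (cayley_graph (dihedral n) S) \<longleftrightarrow>
    (\<forall>h::nat. 1 \<le> h \<and> h \<le> (n - 1) div 2 \<longrightarrow>
      (chi_sum n h S1 \<in> \<int> \<and> chi_sum_sq n h S1 + chi_sum_sq n h S2 \<in> \<int>) \<and>
      is_square_number (Delta n h S1 S2))"
proof -
  have S1: "S1 \<subseteq> {False} \<times> {0..<int n}"
    using assms(2,3,5) generate_rotation[OF assms(1)] by fastforce
  have "fst x" if "x \<in> S2" for x
  proof -
    from that assms(6) obtain y where y: "y \<in> generate (dihedral n) {dih_a n}"
      "x = dih_b \<otimes>\<^bsub>dihedral n\<^esub> y" by (auto simp: l_coset_def)
    with generate_rotation[OF assms(1) y(1)] show ?thesis
      by (simp add: fst_dihedral_mult dih_b_def)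
  qed
  with assms(2,3) have S2: "S2 \<subseteq> {True} \<times> {0..<int n}" by fastforce
  have "(False, - k mod int n) \<in> S1" if "(False, k) \<in> S1" for k
  proof -
    have "inv\<^bsub>dihedral n\<^esub> (False, k) \<in> S"
      using that assms(2,4) by (auto simp: SET_INV_def)
    moreover have "inv\<^bsub>dihedral n\<^esub> (False, k) = (False, - k mod int n)"
      using that S1 assms(1) by (intro dihedral_inv_rotation) auto
    \<comment> \<open>The inverse lies in \<open>S\<close> and is a rotation, so it cannot lie in
      \<open>S2\<close>.\<close>
    ultimately show ?thesis using assms(2) S2 by auto
  qed
  with assms(1) S1 S2 interpret dihedral_connection n S1 S2
    by unfold_locales
  show ?thesis
    unfolding assms(2) integral_iff_half chi_sum_S1 chi_sum_sq_S1 chi_sum_sq_S2 Delta_eq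
      sum_diff_Ints_iff ..
qed

end
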